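(* Let $A \neq B$ be two strings of the same length $n$ over $\{\mathrm{H},\mathrm{T}\}$. If the No-Flippancy game with Alice's string $A$ and Bob's string $B$ takes longer than $4n-4$ turns, then it must be infinite.
   Context: No-Flippancy game: Alice and Bob have distinct strings $A=A_1\cdots A_n$ and $B=B_1\cdots B_n$ of the same length $n$ over the alphabet $\{\mathrm{H},\mathrm{T}\}$. Starting from the empty sequence, the players alternate turns, Alice going first, and on each turn the current player appends one letter to the sequence (the game output) as follows: let $i<n$ be the maximal length of a suffix of the current sequence that coincides with a prefix of the current player's string ($i=0$ is allowed, via the empty suffix); the player appends the letter with index $i+1$ of their own string. The game ends as soon as $A$ or $B$ appears as a block of consecutive letters in the sequence (necessarily as its suffix, no matter who made the last move); the player whose string appears first wins. If neither string ever appears, the game is infinite. The number of turns is the number of letters appended.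
   Formalization: The length n is assumed to be at least 2; for n = 1 the claim fails, since Alice wins on the first turn, which is more than 4n-4 = 0 turns, and the game is finite. *)

theory Defs
  imports Main "HOL-Library.Sublist" "HOL-Library.Extended_Nat"
begin

datatype coin = H | T

text \<open>The 1-based letter with index \<open>i + 1\<close> of the player's string \<open>P\<close> is \<open>P ! i\<close>.
  For nonempty \<open>P\<close> the maximum is taken over a finite set that contains \<open>0\<close>.\<close>

definition overlap :: "coin list \<Rightarrow> coin list \<Rightarrow> nat" where
  "overlap P s = Max {i. i < length P \<and> suffix (take i P) s}"

definition next_letter :: "coin list \<Rightarrow> coin list \<Rightarrow> coin" where
  "next_letter P s = P ! overlap P s"

definition game_over :: "coin list \<Rightarrow> coin list \<Rightarrow> coin list \<Rightarrow> bool" where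
  "game_over A B s \<longleftrightarrow> sublist A s \<or> sublist B s"

text \<open>The sequence after at most \<open>k\<close> turns: once the game is over, it no longer changes.
  Alice moves on turns \<open>1, 3, 5, \<dots>\<close>, that is, when an even number of turns has been played.\<close>

fun output_after :: "coin list \<Rightarrow> coin list \<Rightarrow> nat \<Rightarrow> coin list" where
  "output_after A B 0 = []"
| "output_after A B (Suc k) =
     (let s = output_after A B k in
      if game_over A B s then s
      else s @ [next_letter (if even k then A else B) s])"

text \<open>The total number of letters appended, \<open>\<infinity>\<close> if the game never stops.\<close>

definition num_turns :: "coin list \<Rightarrow> coin list \<Rightarrow> enat" where
  "num_turns A B = (SUP k. enat (length (output_after A B k)))"

definition infinite_game :: "coin list \<Rightarrow> coin list \<Rightarrow> bool" where
  "infinite_game A B \<longleftrightarrow> (\<forall>k. \<not> game_over A B (output_after A B k))"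

end

theory Submission
  imports Defs
begin

text \<open>While the game runs, every match of a proper prefix of \<open>A\<close> or \<open>B\<close> with a suffix of the
  output can be read off from the longest such match. Hence the future of the game depends only on
  whose match is longest, on its length (between \<open>1\<close> and \<open>n - 1\<close>) and on who moves next.
  Just before Alice's moves after the first one, one of the two states with longest match of
  length \<open>1\<close> cannot occur: \<open>(Bob, 1)\<close> if \<open>A\<close> and \<open>B\<close> have the same first letter (ties
  are counted as Alice's), and \<open>(Alice, 1)\<close> otherwise. So there are at most \<open>2 n - 3\<close> states for the
  \<open>2 n - 2\<close> positions after \<open>2, 4, \<dots>, 4 n - 4\<close> turns, one state recurs, and the game is periodic.\<close>

lemma overlap_less:
  assumes "P \<noteq> []"
  shows "overlap P s < length P"
    and suffix_take_overlap: "suffix (take (overlap P s) P) s"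
proof -
  let ?M = "{i. i < length P \<and> suffix (take i P) s}"
  have "0 \<in> ?M" using assms by simp
  then have "Max ?M \<in> ?M" by (intro Max_in) auto
  then show "overlap P s < length P" "suffix (take (overlap P s) P) s"
    by (auto simp: overlap_def)
qed

lemma le_overlap: "i < length P \<Longrightarrow> suffix (take i P) s \<Longrightarrow> i \<le> overlap P s"
  unfolding overlap_def by (rule Max_ge) auto

text \<open>Equality of outputs as the owner of \<open>P\<close> sees them: it fixes the owner's
  next letter and survives appending the same letter to both. Only proper prefixes count, since a
  full match ends the game.\<close>

definition same_matches :: "coin list \<Rightarrow> coin list \<Rightarrow> coin list \<Rightarrow> bool" where
  "same_matches P s t \<longleftrightarrow> (\<forall>i < length P. suffix (take i P) s \<longleftrightarrow> suffix (take i P) t)"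

lemma same_matches_sym: "same_matches P s t \<Longrightarrow> same_matches P t s"
  by (simp add: same_matches_def)

lemma same_matches_trans: "same_matches P s t \<Longrightarrow> same_matches P t u \<Longrightarrow> same_matches P s u"
  by (simp add: same_matches_def)

lemma same_matches_next_letter: "same_matches P s t \<Longrightarrow> next_letter P s = next_letter P t"
  unfolding same_matches_def next_letter_def overlap_def
  by (rule arg_cong[where f = "\<lambda>M. P ! Max M"]) auto

text \<open>A match of length \<open>j + 1\<close> after appending \<open>c\<close> is a match of
  length \<open>j\<close> before it, together with \<open>P ! j = c\<close>. Allowing
  \<open>i = length P\<close> covers a win.\<close>

lemma same_matches_suffix_snoc:
  assumes "same_matches P s t" "i \<le> length P"
  shows "suffix (take i P) (s @ [c]) \<longleftrightarrow> suffix (take i P) (t @ [c])"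
proof (cases i)
  case (Suc j)
  then have "take i P = take j P @ [P ! j]" "j < length P"
    using assms by (auto simp: take_Suc_conv_app_nth)
  then show ?thesis using assms by (auto simp: same_matches_def)
qed simp

lemma same_matches_snoc: "same_matches P s t \<Longrightarrow> same_matches P (s @ [c]) (t @ [c])"
  using same_matches_suffix_snoc unfolding same_matches_def[of P "s @ [c]"] by simp

text \<open>Every match of a proper prefix of \<open>P\<close> with \<open>s\<close> is short enough
  to lie inside \<open>u\<close>.\<close>

lemma same_matches_suffix:
  assumes "suffix u s" "P \<noteq> []" "overlap P s \<le> length u"
  shows "same_matches P s u"
  unfolding same_matches_def
proof (intro allI impI iffI)
  fix i assume i: "i < length P"
  { assume "suffix (take i P) s"
    moreover from le_overlap[OF i this] assms(3) have "length (take i P) \<le> length u" by simp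
    ultimately show "suffix (take i P) u" using assms(1) suffix_length_suffix by blast }
  show "suffix (take i P) s" if "suffix (take i P) u"
    using that assms(1) suffix_order.trans by blast
qed

text \<open>An occurrence that is new after appending \<open>c\<close> must end at \<open>c\<close>,
  so it is a full match, decided by the matches one letter shorter.\<close>

lemma game_over_snoc:
  assumes "A \<noteq> []" "B \<noteq> []" "\<not> game_over A B s" "\<not> game_over A B t"
    and "same_matches A s t" "same_matches B s t"
  shows "game_over A B (s @ [c]) \<longleftrightarrow> game_over A B (t @ [c])"
proof -
  have "sublist P (x @ [c]) \<longleftrightarrow> suffix P (x @ [c]) \<or> sublist P x" for P x
    by (metis sublist_appendI sublist_snoc)
  then show ?thesis
    using assms same_matches_suffix_snoc[of A s t "length A" c]
      same_matches_suffix_snoc[of B s t "length B" c]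
    by (auto simp: game_over_def)
qed

definition longest_match :: "coin list \<Rightarrow> coin list \<Rightarrow> coin list \<Rightarrow> bool \<times> nat" where
  "longest_match A B s =
    (overlap B s \<le> overlap A s, max (overlap A s) (overlap B s))"

lemma longest_match_eq_imp_same_matches:
  assumes "A \<noteq> []" "B \<noteq> []" "longest_match A B s = longest_match A B t"
  shows "same_matches A s t" "same_matches B s t"
proof -
  \<comment> \<open>The longest match as a word: a suffix of \<open>x\<close> at least as long as
    either overlap, and recoverable from \<open>longest_match A B x\<close> alone.\<close>
  define u where "u x = (if overlap B x \<le> overlap A x
    then take (overlap A x) A else take (overlap B x) B)" for x
  have "same_matches A x (u x)" "same_matches B x (u x)" for x
    using suffix_take_overlap[OF assms(1), of x] suffix_take_overlap[OF assms(2), of x]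
      overlap_less[OF assms(1), of x] overlap_less[OF assms(2), of x] assms(1,2)
    by (auto simp: u_def intro!: same_matches_suffix)
  moreover have "u s = u t"
    using assms(3) by (auto simp: u_def longest_match_def max_def split: if_splits)
  ultimately show "same_matches A s t" "same_matches B s t"
    by (metis same_matches_sym same_matches_trans)+
qed

lemma output_after_game_over:
  "game_over A B (output_after A B k) \<Longrightarrow> output_after A B (k + d) = output_after A B k"
  by (induction d) (auto simp: Let_def)

lemma game_over_mono:
  "game_over A B (output_after A B k) \<Longrightarrow> k \<le> m \<Longrightarrow> game_over A B (output_after A B m)"
  by (metis le_Suc_ex output_after_game_over)

lemma length_output_after_le: "length (output_after A B k) \<le> k"
  by (induction k) (auto simp: Let_def)

lemma num_turns_le_if_game_over:
  assumes "game_over A B (output_after A B m)"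
  shows "num_turns A B \<le> enat m"
  unfolding num_turns_def
proof (rule SUP_least)
  fix k
  have "length (output_after A B k) \<le> m"
  proof (cases "k \<le> m")
    case True
    then show ?thesis using length_output_after_le[of A B k] by simp
  next
    case False
    then have "output_after A B k = output_after A B m"
      using output_after_game_over[OF assms, of "k - m"] by simp
    then show ?thesis using length_output_after_le[of A B m] by simp
  qed
  then show "enat (length (output_after A B k)) \<le> enat m" by simp
qed

lemma infinite_game_if_longest_match_recurs:
  assumes "A \<noteq> []" "B \<noteq> []" "i < j" "even (j - i)"
    and j: "\<not> game_over A B (output_after A B j)"
    and eq: "longest_match A B (output_after A B i) = longest_match A B (output_after A B j)"
  shows "infinite_game A B"
proof -
  let ?s = "output_after A B"
  have alive: "\<not> game_over A B (?s (j + d)) \<and>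
    same_matches A (?s (i + d)) (?s (j + d)) \<and> same_matches B (?s (i + d)) (?s (j + d))" for d
  proof (induction d)
    case 0
    show ?case using j longest_match_eq_imp_same_matches[OF assms(1,2) eq] by simp
  next
    case (Suc d)
    have over_i: "\<not> game_over A B (?s (i + d))"
      using Suc game_over_mono[of A B "i + d" "j + d"] assms(3) by auto
    define c where "c = next_letter (if even (i + d) then A else B) (?s (i + d))"
    have step_i: "?s (i + Suc d) = ?s (i + d) @ [c]"
      using over_i by (simp add: Let_def c_def)
    \<comment> \<open>The even period puts the same player on the move in both runs.\<close>
    have "even (i + d) = even (j + d)" using assms(3,4) by auto
    then have "c = next_letter (if even (j + d) then A else B) (?s (j + d))"
      using Suc by (auto simp: c_def intro: same_matches_next_letter)
    then have step_j: "?s (j + Suc d) = ?s (j + d) @ [c]"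
      using Suc by (simp add: Let_def)
    \<comment> \<open>Since \<open>i < j\<close>, position \<open>i + Suc d\<close> is at most
      \<open>j + d\<close>, where the game is still running; this survival is then transferred to
      \<open>j + Suc d\<close>.\<close>
    have "\<not> game_over A B (?s (i + Suc d))"
      using Suc game_over_mono[of A B "i + Suc d" "j + d"] assms(3)
      by (auto simp del: output_after.simps)
    then have "\<not> game_over A B (?s (j + Suc d))"
      using game_over_snoc[OF assms(1,2) over_i, of "?s (j + d)" c] Suc step_i step_j by auto
    then show ?case using Suc same_matches_snoc step_i step_j by simp
  qed
  have "\<not> game_over A B (?s k)" for k
    using alive[of k] game_over_mono[of A B k "j + k"] by auto
  then show ?thesis by (simp add: infinite_game_def)
qed

text \<open>The mover's letter lengthens their longest match by one, and the result is still a
  proper prefix unless it completes \<open>P\<close>.\<close>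

lemma overlap_snoc_next_letter_pos:
  assumes "P \<noteq> []" "\<not> suffix P (s @ [next_letter P s])"
  shows "0 < overlap P (s @ [next_letter P s])"
proof -
  let ?i = "overlap P s"
  have suf: "suffix (take (Suc ?i) P) (s @ [next_letter P s])"
    using overlap_less[OF assms(1), of s]
    by (simp add: take_Suc_conv_app_nth next_letter_def suffix_take_overlap[OF assms(1)])
  then have "Suc ?i \<noteq> length P" using assms(2) by auto
  then have "Suc ?i < length P" using overlap_less[OF assms(1), of s] by simp
  from le_overlap[OF this suf] show ?thesis by simp
qed

lemma last_eq_hd_if_overlap_eq_1:
  assumes "P \<noteq> []" "overlap P s = 1"
  shows "suffix [hd P] s"
  using suffix_take_overlap[OF assms(1), of s] assms by (cases P) auto

lemma longest_match_after_Bob: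
  assumes "n \<ge> 2" "length A = n" "length B = n" "k > 0"
    and alive: "\<not> game_over A B (output_after A B (2 * k))"
  shows "longest_match A B (output_after A B (2 * k)) \<in> UNIV \<times> {1..n - 1} - {(hd A \<noteq> hd B, 1)}"
proof -
  define s where "s = output_after A B (2 * k)"
  have ne: "A \<noteq> []" "B \<noteq> []" using assms by auto
  define j where "j = 2 * k - 1"
  then have j: "2 * k = Suc j" "odd j" using assms(4) by simp_all
  have "\<not> game_over A B (output_after A B j)"
    using alive game_over_mono[of A B j "2 * k"] unfolding j(1)
    by (auto simp del: output_after.simps)
  then have "s = output_after A B j @ [next_letter B (output_after A B j)]"
    using j(2) unfolding s_def j(1) by (simp add: Let_def)
  moreover have "\<not> suffix B s" using alive by (auto simp: s_def game_over_def)
  ultimately have b: "0 < overlap B s"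
    using overlap_snoc_next_letter_pos[OF ne(2)] by simp
  \<comment> \<open>In this state Bob's overlap would be 1, so \<open>s\<close> ends in
    \<open>hd B\<close>. With equal heads Alice then ties, so the flag is \<open>True\<close>; with
    distinct heads Alice's overlap would also be 1, and \<open>s\<close> would end in two different
    letters.\<close>
  have "longest_match A B s \<noteq> (hd A \<noteq> hd B, 1)"
  proof
    assume eq: "longest_match A B s = (hd A \<noteq> hd B, 1)"
    then have "overlap B s = 1" using b by (auto simp: longest_match_def)
    then have sB: "suffix [hd B] s" by (rule last_eq_hd_if_overlap_eq_1[OF ne(2)])
    show False
    proof (cases "hd A = hd B")
      case True
      then have "1 \<le> overlap A s"
        using sB assms(1,2) ne by (intro le_overlap) (auto simp: take_Suc)
      then show False using eq True \<open>overlap B s = 1\<close> by (simp add: longest_match_def)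
    next
      case False
      then have "overlap A s = 1" using eq b by (auto simp: longest_match_def)
      then have "suffix [hd A] s" by (rule last_eq_hd_if_overlap_eq_1[OF ne(1)])
      then show False using sB False by (auto simp: suffix_def)
    qed
  qed
  then show ?thesis
    using b overlap_less[OF ne(1), of s] overlap_less[OF ne(2), of s] assms(2,3)
    by (auto simp: longest_match_def s_def)
qed

theorem lemma1:
  fixes A B :: "coin list" and n :: nat
  assumes "n \<ge> 2"
    and "length A = n" and "length B = n" and "A \<noteq> B"
    and "num_turns A B > enat (4 * n - 4)"
  shows "infinite_game A B"
proof -
  let ?s = "output_after A B"
  let ?f = "\<lambda>k. longest_match A B (?s (2 * k))"
  let ?S = "UNIV \<times> {1..n - 1} - {(hd A \<noteq> hd B, 1)}"
  have last: "\<not> game_over A B (?s (4 * n - 4))"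
    using num_turns_le_if_game_over[of A B "4 * n - 4"] assms(5) by auto
  \<comment> \<open>The range starts at 1 because the empty output has only empty matches, giving a
    state outside \<open>?S\<close>.\<close>
  have alive: "\<not> game_over A B (?s (2 * k))" if "k \<in> {1..2 * n - 2}" for k
  proof -
    have "2 * k \<le> 4 * n - 4" using that assms(1) unfolding atLeastAtMost_iff by linarith
    with last show ?thesis by (metis game_over_mono)
  qed
  have "?f ` {1..2 * n - 2} \<subseteq> ?S"
  proof (rule image_subsetI)
    fix k assume k: "k \<in> {1..2 * n - 2}"
    show "?f k \<in> ?S" by (rule longest_match_after_Bob[OF assms(1-3) _ alive[OF k]]) (use k in simp)
  qed
  moreover have "finite ?S" by simp
  \<comment> \<open>The removed pair lies in the product because \<open>n \<ge> 2\<close>, which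
    leaves \<open>2 * (n - 1) - 1\<close> states.\<close>
  moreover have "card ?S = 2 * n - 3"
    using assms(1) by (subst card_Diff_singleton) (auto simp: card_cartesian_product)
  ultimately have "card (?f ` {1..2 * n - 2}) < card {1..2 * n - 2}"
    using assms(1) card_mono[of ?S "?f ` {1..2 * n - 2}"] by simp
  then have "\<not> inj_on ?f {1..2 * n - 2}" by (rule pigeonhole)
  then obtain i j where ij: "i \<in> {1..2 * n - 2}" "j \<in> {1..2 * n - 2}" "i < j" "?f i = ?f j"
    by (rule contrapos_np) (rule linorder_inj_onI', blast)
  have "A \<noteq> []" "B \<noteq> []" using assms(1-3) by auto
  then show ?thesis
    using ij alive[OF ij(2)]
    by (intro infinite_game_if_longest_match_recurs[of A B "2 * i" "2 * j"]) auto
qed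

end
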